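(* Let $P$ be a disjunctive logic program. A set of atoms $M$ is a possible model of $P$ (in the sense of Sakama and Inoue) if and only if $M$ is a stable model of the mca-program $\mathit{mca}_d(P)$.
   Context: For a disjunctive clause $r = c_1\vee\ldots\vee c_k\leftarrow a_1,\ldots,a_m,\mathbf{not}(b_1),\ldots,\mathbf{not}(b_n)$ (all $a_i,b_i,c_i$ atoms), $\mathit{mca}_d(r)$ is the mca-clause $1\{c_1,\ldots,c_k\}\leftarrow 1\{a_1\},\ldots,1\{a_m\},\mathbf{not}(1\{b_1\}),\ldots,\mathbf{not}(1\{b_n\})$, and $\mathit{mca}_d(P)=\{\mathit{mca}_d(r): r\in P\}$. Here an mc-atom $kX$ ($X$ a finite set of atoms, $k\le|X|$) is satisfied by $M$ iff $|M\cap X|\ge k$, and $\mathbf{not}(kX)$ iff $|M\cap X|<k$. For an mca-program $Q$ and a set $M$: $Q(M)$ is the set of clauses whose bodies $M$ satisfies; $T^{nd}_Q(M)$ is the set of all $M'$ contained in the union of the head atom sets of clauses in $Q(M)$ and satisfying every head of a clause in $Q(M)$; for a Horn (negation-free) $Q$, a derivable model is $\bigcup_n X_n$ for a sequence $X_0=\emptyset\subseteq X_1\subseteq\cdots$ with $X_{n+1}\in T^{nd}_Q(X_n)$. The reduct $Q^M$ removes clauses having a body literal $\mathbf{not}(A)$ with $M\models A$ and deletes remaining $\mathbf{not}(A)$ literals; $M$ is a stable model of $Q$ if it is a derivable model of $Q^M$. *)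

theory Defs
  imports Main
begin

section \<open>Programs with monotone cardinality atoms\<close>

datatype 'a mc_atom = MC (mc_bound: nat) (mc_set: "'a set")

definition mc_atom :: "'a mc_atom \<Rightarrow> bool" where
  "mc_atom A \<longleftrightarrow> finite (mc_set A) \<and> mc_bound A \<le> card (mc_set A)"

definition mc_sat :: "'a set \<Rightarrow> 'a mc_atom \<Rightarrow> bool" where
  "mc_sat M A \<longleftrightarrow> mc_bound A \<le> card (M \<inter> mc_set A)"

text \<open>The third component lists the mc-atoms that occur negated in the body.\<close>

datatype 'a mca_clause =
  MCA_Clause (mca_head: "'a mc_atom") (mca_pos: "'a mc_atom list") (mca_neg: "'a mc_atom list")

type_synonym 'a mca_program = "'a mca_clause set"

definition mca_program :: "'a mca_program \<Rightarrow> bool" where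
  "mca_program Q \<longleftrightarrow>
     (\<forall>r\<in>Q. \<forall>A \<in> insert (mca_head r) (set (mca_pos r) \<union> set (mca_neg r)). mc_atom A)"

definition mca_horn :: "'a mca_program \<Rightarrow> bool" where
  "mca_horn Q \<longleftrightarrow> (\<forall>r\<in>Q. mca_neg r = [])"

definition mca_body_sat :: "'a set \<Rightarrow> 'a mca_clause \<Rightarrow> bool" where
  "mca_body_sat M r \<longleftrightarrow>
     (\<forall>A\<in>set (mca_pos r). mc_sat M A) \<and> (\<forall>A\<in>set (mca_neg r). \<not> mc_sat M A)"

definition mca_applicable :: "'a mca_program \<Rightarrow> 'a set \<Rightarrow> 'a mca_program" where
  "mca_applicable Q M = {r \<in> Q. mca_body_sat M r}"

definition Tnd :: "'a mca_program \<Rightarrow> 'a set \<Rightarrow> 'a set set" where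
  "Tnd Q M = {M'. M' \<subseteq> (\<Union>r\<in>mca_applicable Q M. mc_set (mca_head r)) \<and>
                  (\<forall>r\<in>mca_applicable Q M. mc_sat M' (mca_head r))}"

definition derivable_model :: "'a mca_program \<Rightarrow> 'a set \<Rightarrow> bool" where
  "derivable_model Q M \<longleftrightarrow>
     (\<exists>X :: nat \<Rightarrow> 'a set. X 0 = {} \<and> (\<forall>n. X n \<subseteq> X (Suc n)) \<and>
        (\<forall>n. X (Suc n) \<in> Tnd Q (X n)) \<and> M = (\<Union>n. X n))"

definition mca_reduct :: "'a mca_program \<Rightarrow> 'a set \<Rightarrow> 'a mca_program" where
  "mca_reduct Q M =
     {MCA_Clause (mca_head r) (mca_pos r) [] | r. r \<in> Q \<and> (\<forall>A\<in>set (mca_neg r). \<not> mc_sat M A)}"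

lemma mca_horn_reduct: "mca_horn (mca_reduct Q M)"
  by (auto simp: mca_horn_def mca_reduct_def)

definition mca_stable_model :: "'a mca_program \<Rightarrow> 'a set \<Rightarrow> bool" where
  "mca_stable_model Q M \<longleftrightarrow> derivable_model (mca_reduct Q M) M"

section \<open>Normal logic programs\<close>

datatype 'a normal_clause =
  Normal_Clause (n_head: 'a) (n_pos: "'a list") (n_neg: "'a list")

type_synonym 'a normal_program = "'a normal_clause set"

definition n_model :: "'a normal_program \<Rightarrow> 'a set \<Rightarrow> bool" where
  "n_model N M \<longleftrightarrow>
     (\<forall>r\<in>N. set (n_pos r) \<subseteq> M \<and> set (n_neg r) \<inter> M = {} \<longrightarrow> n_head r \<in> M)"

definition n_least_model :: "'a normal_program \<Rightarrow> 'a set \<Rightarrow> bool" where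
  "n_least_model N M \<longleftrightarrow> n_model N M \<and> (\<forall>M'. n_model N M' \<longrightarrow> M \<subseteq> M')"

text \<open>Gelfond--Lifschitz reduct.\<close>

definition n_reduct :: "'a normal_program \<Rightarrow> 'a set \<Rightarrow> 'a normal_program" where
  "n_reduct N M = {Normal_Clause (n_head r) (n_pos r) [] | r. r \<in> N \<and> set (n_neg r) \<inter> M = {}}"

definition n_stable_model :: "'a normal_program \<Rightarrow> 'a set \<Rightarrow> bool" where
  "n_stable_model N M \<longleftrightarrow> n_least_model (n_reduct N M) M"

section \<open>Disjunctive logic programs and possible models\<close>

datatype 'a disj_clause =
  Disj_Clause (d_head: "'a list") (d_pos: "'a list") (d_neg: "'a list")

type_synonym 'a disj_program = "'a disj_clause set"

text \<open>
  Every clause has at least one head atom (\<open>k \<ge> 1\<close>): otherwise the head of its translation,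
  \<open>1 {}\<close>, would not be an mc-atom. Programs may be infinite.
\<close>

definition disj_program :: "'a disj_program \<Rightarrow> bool" where
  "disj_program P \<longleftrightarrow> (\<forall>r\<in>P. d_head r \<noteq> [])"

text \<open>
  Sakama and Inoue: a split program replaces each disjunctive clause by the normal clauses
  with the same body whose heads range over some nonempty subset of its head atoms;
  the possible models are the stable models of the split programs.
\<close>

definition split_program :: "'a disj_program \<Rightarrow> 'a normal_program \<Rightarrow> bool" where
  "split_program P N \<longleftrightarrow>
     (\<exists>S. (\<forall>r\<in>P. S r \<noteq> {} \<and> S r \<subseteq> set (d_head r)) \<and>
          N = {Normal_Clause c (d_pos r) (d_neg r) | r c. r \<in> P \<and> c \<in> S r})"

definition possible_model :: "'a disj_program \<Rightarrow> 'a set \<Rightarrow> bool" where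
  "possible_model P M \<longleftrightarrow> (\<exists>N. split_program P N \<and> n_stable_model N M)"

definition mca_d_clause :: "'a disj_clause \<Rightarrow> 'a mca_clause" where
  "mca_d_clause r =
     MCA_Clause (MC 1 (set (d_head r)))
       (map (\<lambda>a. MC 1 {a}) (d_pos r)) (map (\<lambda>b. MC 1 {b}) (d_neg r))"

definition mca_d :: "'a disj_program \<Rightarrow> 'a mca_program" where
  "mca_d P = mca_d_clause ` P"

lemma mca_program_mca_d: "disj_program P \<Longrightarrow> mca_program (mca_d P)"
  by (auto simp: disj_program_def mca_program_def mc_atom_def mca_d_def mca_d_clause_def
      Suc_le_eq card_gt_0_iff)

end

(*
  If M is the union of a derivation X of mca_d P, split each clause r whose body holds in M into
  the normal clauses with heads in "d_head r \<inter> M"; then M is the least model of the reduct.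
  Conversely, the iterates of the one-step operator of the reduct of a split program form
  a derivation of mca_d P. Finiteness of clause bodies is what lets a body that holds in the
  limit hold already at a finite stage.
*)

theory Submission
  imports Defs
begin

lemma mc_sat_one: "mc_sat M (MC 1 (set xs)) \<longleftrightarrow> M \<inter> set xs \<noteq> {}"
  by (simp add: mc_sat_def Suc_le_eq card_gt_0_iff)

lemma mc_sat_one_singleton: "mc_sat M (MC 1 {a}) \<longleftrightarrow> a \<in> M"
  using mc_sat_one[of M "[a]"] by simp

text \<open>Negation is judged against the fixed \<open>M\<close>, positive bodies against the
  varying \<open>Y\<close>. This is what taking a reduct at \<open>M\<close> and then applying it at
  \<open>Y\<close> amounts to, so one set of clauses serves both kinds of program.\<close>

definition d_applicable :: "'a disj_program \<Rightarrow> 'a set \<Rightarrow> 'a set \<Rightarrow> 'a disj_program" where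
  "d_applicable P M Y = {r \<in> P. set (d_neg r) \<inter> M = {} \<and> set (d_pos r) \<subseteq> Y}"

lemma mca_reduct_mca_d:
  "mca_reduct (mca_d P) M =
     (\<lambda>r. MCA_Clause (MC 1 (set (d_head r))) (map (\<lambda>a. MC 1 {a}) (d_pos r)) [])
       ` {r \<in> P. set (d_neg r) \<inter> M = {}}"
proof -
  have "mca_reduct (mca_d P) M =
      {MCA_Clause (mca_head (mca_d_clause r)) (mca_pos (mca_d_clause r)) [] | r.
        r \<in> P \<and> (\<forall>A\<in>set (mca_neg (mca_d_clause r)). \<not> mc_sat M A)}"
    unfolding mca_reduct_def mca_d_def by blast
  also have "\<dots> = {MCA_Clause (MC 1 (set (d_head r))) (map (\<lambda>a. MC 1 {a}) (d_pos r)) [] | r.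
        r \<in> P \<and> (\<forall>b\<in>set (d_neg r). b \<notin> M)}"
    \<comment> \<open>\<open>[simplified]\<close> turns the bound \<open>1\<close> into
      \<open>Suc 0\<close>, the form that the simplifier gives it in the goal.\<close>
    by (simp add: mca_d_clause_def mc_sat_one_singleton[simplified])
  finally show ?thesis by auto
qed

lemma mca_applicable_reduct_mca_d:
  "mca_applicable (mca_reduct (mca_d P) M) Y =
     (\<lambda>r. MCA_Clause (MC 1 (set (d_head r))) (map (\<lambda>a. MC 1 {a}) (d_pos r)) [])
       ` d_applicable P M Y"
proof -
  have "mca_body_sat Y (MCA_Clause (MC 1 (set (d_head r))) (map (\<lambda>a. MC 1 {a}) (d_pos r)) [])
      \<longleftrightarrow> set (d_pos r) \<subseteq> Y" for r :: "'a disj_clause"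
    by (auto simp: mca_body_sat_def mc_sat_one_singleton[simplified])
  then show ?thesis
    unfolding mca_applicable_def mca_reduct_mca_d d_applicable_def by blast
qed

text \<open>Eliminates mc-atoms: since every bound is \<open>1\<close>, satisfying a head means
  meeting its atom set.\<close>

lemma Tnd_reduct_mca_d:
  "X \<in> Tnd (mca_reduct (mca_d P) M) Y \<longleftrightarrow>
     X \<subseteq> (\<Union>r\<in>d_applicable P M Y. set (d_head r)) \<and>
     (\<forall>r\<in>d_applicable P M Y. X \<inter> set (d_head r) \<noteq> {})"
  by (simp add: Tnd_def mca_applicable_reduct_mca_d mc_sat_one[simplified])

definition split_by :: "'a disj_program \<Rightarrow> ('a disj_clause \<Rightarrow> 'a set) \<Rightarrow> 'a normal_program" where
  "split_by P S = {Normal_Clause c (d_pos r) (d_neg r) | r c. r \<in> P \<and> c \<in> S r}"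

text \<open>The normal clauses split from \<open>r\<close> share its body, so together they demand
  all of \<open>S r\<close> as soon as that body holds.\<close>

lemma n_model_reduct_split_by:
  "n_model (n_reduct (split_by P S) M) M' \<longleftrightarrow> (\<forall>r\<in>d_applicable P M M'. S r \<subseteq> M')"
proof -
  have reduct: "n_reduct (split_by P S) M =
      {Normal_Clause c (d_pos r) [] | r c. r \<in> P \<and> c \<in> S r \<and> set (d_neg r) \<inter> M = {}}"
    unfolding n_reduct_def split_by_def by force
  have ball: "(\<forall>x\<in>{f r c | r c. Q r c}. \<phi> x) \<longleftrightarrow> (\<forall>r c. Q r c \<longrightarrow> \<phi> (f r c))"
    for f :: "'a disj_clause \<Rightarrow> 'a \<Rightarrow> 'a normal_clause" and Q \<phi>
    by blast
  have "n_model (n_reduct (split_by P S) M) M' \<longleftrightarrow>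
      (\<forall>r c. r \<in> P \<and> c \<in> S r \<and> set (d_neg r) \<inter> M = {} \<longrightarrow> set (d_pos r) \<subseteq> M' \<longrightarrow> c \<in> M')"
    unfolding n_model_def reduct ball by simp
  also have "\<dots> \<longleftrightarrow> (\<forall>r. r \<in> d_applicable P M M' \<longrightarrow> (\<forall>c. c \<in> S r \<longrightarrow> c \<in> M'))"
    unfolding d_applicable_def mem_Collect_eq by iprover
  finally show ?thesis
    by (simp only: Ball_def subset_iff)
qed

lemma possible_model_iff:
  "possible_model P M \<longleftrightarrow>
     (\<exists>S. (\<forall>r\<in>P. S r \<noteq> {} \<and> S r \<subseteq> set (d_head r)) \<and> n_stable_model (split_by P S) M)"
  unfolding possible_model_def split_program_def split_by_def by blast

text \<open>Each of the finitely many list elements enters at some stage, and the maximum of these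
  stages serves them all.\<close>

lemma set_subset_UN_incseq:
  fixes X :: "nat \<Rightarrow> 'a set"
  assumes "mono X" "set xs \<subseteq> (\<Union>n. X n)"
  shows "\<exists>n. set xs \<subseteq> X n"
  using assms(2)
proof (induction xs)
  case (Cons x xs)
  then obtain m n where "x \<in> X m" "set xs \<subseteq> X n" by auto
  with monoD[OF \<open>mono X\<close>, of m "max m n"] monoD[OF \<open>mono X\<close>, of n "max m n"]
  have "set (x # xs) \<subseteq> X (max m n)" by auto
  then show ?case ..
qed simp

text \<open>Continuity of applicability along increasing sequences: a finite positive body that
  holds in the limit already holds at some stage, and the negative part does not depend on the
  stage.\<close>

lemma d_applicable_UN:
  fixes X :: "nat \<Rightarrow> 'a set"
  assumes "mono X"
  shows "d_applicable P M (\<Union>n. X n) = (\<Union>n. d_applicable P M (X n))"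
  using set_subset_UN_incseq[OF assms] unfolding d_applicable_def by fast

lemma d_applicable_mono: "Y \<subseteq> Z \<Longrightarrow> d_applicable P M Y \<subseteq> d_applicable P M Z"
  unfolding d_applicable_def by auto

lemma possible_model_imp_mca_stable_model:
  assumes "possible_model P M"
  shows "mca_stable_model (mca_d P) M"
proof -
  obtain S where S: "\<forall>r\<in>P. S r \<noteq> {} \<and> S r \<subseteq> set (d_head r)"
    and stable: "n_stable_model (split_by P S) M"
    using assms unfolding possible_model_iff by blast
  have closed: "\<forall>r\<in>d_applicable P M M. S r \<subseteq> M"
    and least: "\<And>M'. \<forall>r\<in>d_applicable P M M'. S r \<subseteq> M' \<Longrightarrow> M \<subseteq> M'"
    using stable by (simp_all add: n_stable_model_def n_least_model_def n_model_reduct_split_by)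
  \<comment> \<open>\<open>T\<close> is the one-step operator of the reduct of the split program;
    its iterates from the empty set will be the derivation.\<close>
  define T where "T Y = (\<Union>r\<in>d_applicable P M Y. S r)" for Y
  define X where "X n = (T ^^ n) {}" for n
  have T_mono: "T Y \<subseteq> T Z" if "Y \<subseteq> Z" for Y Z
    using d_applicable_mono[OF that] unfolding T_def by blast
  have X_Suc: "X (Suc n) = T (X n)" for n
    by (simp add: X_def)
  have step: "X n \<subseteq> X (Suc n)" for n
    by (induction n) (simp add: X_def, metis T_mono X_Suc)
  then have "mono X"
    by (simp add: mono_iff_le_Suc)
  have "X n \<subseteq> M" for n
  proof (induction n)
    case (Suc n)
    have "T M \<subseteq> M"
      using closed unfolding T_def by blast
    with T_mono[OF Suc] show ?case by (simp add: X_Suc)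
  qed (simp add: X_def)
  \<comment> \<open>By continuity the union of the iterates is closed under the reduct, so the least
    model lies below it.\<close>
  moreover have "M \<subseteq> (\<Union>n. X n)"
  proof (rule least, rule ballI)
    fix r assume "r \<in> d_applicable P M (\<Union>n. X n)"
    then obtain n where "r \<in> d_applicable P M (X n)"
      using d_applicable_UN[OF \<open>mono X\<close>] by blast
    then have "S r \<subseteq> X (Suc n)"
      unfolding X_Suc T_def by blast
    then show "S r \<subseteq> (\<Union>n. X n)" by blast
  qed
  ultimately have "M = (\<Union>n. X n)" by blast
  moreover have "X (Suc n) \<in> Tnd (mca_reduct (mca_d P) M) (X n)" for n
  proof -
    have S': "S r \<noteq> {} \<and> S r \<subseteq> set (d_head r)" if "r \<in> d_applicable P M (X n)" for r
      using S that by (simp add: d_applicable_def)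
    \<comment> \<open>Any atom of the nonempty set \<open>S r\<close> is a witness, as
      \<open>T\<close> adds all of \<open>S r\<close>.\<close>
    have "X (Suc n) \<inter> set (d_head r) \<noteq> {}" if "r \<in> d_applicable P M (X n)" for r
      using S'[OF that] that unfolding X_Suc T_def by blast
    moreover have "X (Suc n) \<subseteq> (\<Union>r\<in>d_applicable P M (X n). set (d_head r))"
      unfolding X_Suc T_def using S' by (intro UN_mono) auto
    ultimately show ?thesis
      unfolding Tnd_reduct_mca_d by blast
  qed
  moreover have "X 0 = {}"
    by (simp add: X_def)
  ultimately show ?thesis
    using step unfolding mca_stable_model_def derivable_model_def by blast
qed

lemma mca_stable_model_imp_possible_model:
  assumes P: "disj_program P" and "mca_stable_model (mca_d P) M"
  shows "possible_model P M"
proof -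
  obtain X where X0: "X 0 = {}" and step: "\<And>n. X n \<subseteq> X (Suc n)"
    and Tnd: "\<And>n. X (Suc n) \<in> Tnd (mca_reduct (mca_d P) M) (X n)" and M: "M = (\<Union>n. X n)"
    using assms(2) unfolding mca_stable_model_def derivable_model_def by blast
  have "mono X"
    using step by (simp add: mono_iff_le_Suc)
  \<comment> \<open>A clause not applicable at \<open>M\<close> may have a head disjoint from
    \<open>M\<close>; the full head is then a nonempty default that puts no constraint on
    \<open>M\<close>.\<close>
  define S where
    "S r = (if r \<in> d_applicable P M M then set (d_head r) \<inter> M else set (d_head r))" for r
  have "S r \<noteq> {}" if "r \<in> P" for r
  proof (cases "r \<in> d_applicable P M M")
    case True
    \<comment> \<open>The body holds at a finite stage, so the next stage must contain a head atom,
      which then lies in \<open>M\<close>.\<close>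
    then obtain n where "r \<in> d_applicable P M (X n)"
      using d_applicable_UN[OF \<open>mono X\<close>, of P M] M by blast
    then have "X (Suc n) \<inter> set (d_head r) \<noteq> {}"
      using Tnd[of n] unfolding Tnd_reduct_mca_d by blast
    then show ?thesis
      using True M unfolding S_def by auto
  next
    case False
    then show ?thesis
      using P that by (simp add: S_def disj_program_def)
  qed
  moreover have "S r \<subseteq> set (d_head r)" for r
    by (simp add: S_def)
  moreover have "n_model (n_reduct (split_by P S) M) M"
    by (simp add: n_model_reduct_split_by S_def)
  moreover have "M \<subseteq> M'" if "n_model (n_reduct (split_by P S) M) M'" for M'
  proof -
    have closed: "\<forall>r\<in>d_applicable P M M'. S r \<subseteq> M'"
      using that by (simp add: n_model_reduct_split_by)
    have "X n \<subseteq> M'" for n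
    proof (induction n)
      case (Suc n)
      show ?case
      proof
        fix x assume x: "x \<in> X (Suc n)"
        then obtain r where r: "r \<in> d_applicable P M (X n)" "x \<in> set (d_head r)"
          using Tnd[of n] unfolding Tnd_reduct_mca_d by blast
        \<comment> \<open>These put \<open>r\<close> into the first branch of \<open>S\<close>: it
          is applicable at \<open>M\<close> as well, and its head atom \<open>x\<close> survives the
          intersection with \<open>M\<close>.\<close>
        have "X n \<subseteq> M" and "x \<in> M"
          using x M by auto
        then have "x \<in> S r"
          using r d_applicable_mono unfolding S_def by fastforce
        then show "x \<in> M'"
          using closed r d_applicable_mono[OF Suc] by blast
      qed
    qed (simp add: X0)
    then show ?thesis using M by blast
  qed
  ultimately show ?thesis
    unfolding possible_model_iff n_stable_model_def n_least_model_def by blast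
qed

theorem theorem7:
  fixes P :: "'a disj_program" and M :: "'a set"
  assumes "disj_program P"
  shows "possible_model P M \<longleftrightarrow> mca_stable_model (mca_d P) M"
  using possible_model_imp_mca_stable_model mca_stable_model_imp_possible_model[OF assms]
  by blast

end
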